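(* Let $m$ be a positive integer and let $a_k$ be given. Put $b_k := a_{km}$. (1) If $t_k$ is a hypergeometric term with $b_k = t_k - t_{k-1}$ (as returned by Gosper's algorithm applied to $b_k$), then $s_k := t_{k/m}$ satisfies $$a_k = s_k - s_{k-m},$$ and $s_k/s_{k-m}$ is a rational function with respect to $k$; that is, $s_k$ is an $m$-fold hypergeometric antidifference of $a_k$. (2) If no hypergeometric term $t_k$ with $b_k=t_k-t_{k-1}$ exists, then there is no $m$-fold hypergeometric term $s_k$ with $a_k = s_k - s_{k-m}$.
   Context: All of $a_k, b_k, s_k, t_k$ are expressions in a variable $k$ (rational functions, exponentials, factorials $x!=\Gamma(x+1)$, $\Gamma$ functions, binomial coefficients, Pochhammer symbols with arguments linear in $k$, and combinations of them), regarded as not identically vanishing meromorphic functions of a complex variable $k$, so that the substitutions $k\mapsto km$, $k\mapsto k/m$, $k\mapsto k-1$ make sense; all equations are identities of such functions. A function $t_k$ is a hypergeometric term if $t_k/t_{k-1}$ is a rational function of $k$. A function $s_k$ is an $m$-fold hypergeometric term if $s_k/s_{k-m}$ is a rational function of $k$. Gosper's algorithm is the (known) decision procedure that, given $b_k$, returns a hypergeometric term $t_k$ with $t_k-t_{k-1}=b_k$ if one exists, and otherwise reports that none exists. *)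

theory Defs
  imports "HOL-Complex_Analysis.Complex_Analysis"
begin

text \<open>
  Meromorphic functions are total functions on the complex numbers whose values at singularities
  are meaningless. Hence an identity of meromorphic functions is equality outside a closed discrete
  set, which is what the quantifier \<open>\<forall>\<^sub>\<approx>k\<close> expresses.
\<close>

definition factorial_fun :: "complex \<Rightarrow> complex" where
  "factorial_fun x = Gamma (x + 1)"

definition binomial_fun :: "complex \<Rightarrow> complex \<Rightarrow> complex" where
  "binomial_fun x y =
     factorial_fun x / (factorial_fun y * factorial_fun (x - y))"

definition pochhammer_fun :: "complex \<Rightarrow> complex \<Rightarrow> complex" where
  "pochhammer_fun x n = Gamma (x + n) / Gamma x"

text \<open>
  An exponential with base \<open>c \<noteq> 0\<close> is \<open>exp (z * log c)\<close> for a choice of logarithm of the base, so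
  \<open>exp\<close> with complex linear argument covers all of them. An expression that is undefined everywhere
  (a quotient by an identically vanishing expression, or a Gamma function at a constant
  pole) denotes the zero function up to a discrete set. As the zero function belongs to the class
  anyway, no side conditions are needed to exclude such expressions.
\<close>

inductive_set expressions :: "(complex \<Rightarrow> complex) set" where
  rational: "(\<lambda>k. poly p k / poly q k) \<in> expressions" if "q \<noteq> 0"
| exponential: "(\<lambda>k. exp (\<alpha> * k + \<beta>)) \<in> expressions"
| Gamma: "(\<lambda>k. Gamma (\<alpha> * k + \<beta>)) \<in> expressions"
| factorial: "(\<lambda>k. factorial_fun (\<alpha> * k + \<beta>)) \<in> expressions"
| binomial: "(\<lambda>k. binomial_fun (\<alpha> * k + \<beta>) (\<gamma> * k + \<delta>)) \<in> expressions"
| pochhammer: "(\<lambda>k. pochhammer_fun (\<alpha> * k + \<beta>) (\<gamma> * k + \<delta>)) \<in> expressions"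
| add: "(\<lambda>k. f k + g k) \<in> expressions" if "f \<in> expressions" "g \<in> expressions"
| diff: "(\<lambda>k. f k - g k) \<in> expressions" if "f \<in> expressions" "g \<in> expressions"
| mult: "(\<lambda>k. f k * g k) \<in> expressions" if "f \<in> expressions" "g \<in> expressions"
| divide: "(\<lambda>k. f k / g k) \<in> expressions" if "f \<in> expressions" "g \<in> expressions"

definition admissible :: "(complex \<Rightarrow> complex) \<Rightarrow> bool" where
  "admissible f \<longleftrightarrow>
     f \<in> expressions \<and> f meromorphic_on UNIV \<and> \<not> (\<forall>\<^sub>\<approx>k. f k = 0)"

text \<open>The meromorphy requirement in \<open>admissible\<close> excludes no expression.\<close>

lemma Gamma_linear_meromorphic:
  "(\<lambda>k. Gamma (\<alpha> * k + \<beta> :: complex)) meromorphic_on UNIV"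
proof -
  have "(\<lambda>k. inverse (rGamma (\<alpha> * k + \<beta>))) meromorphic_on UNIV"
    by (intro meromorphic_on_inverse analytic_on_imp_meromorphic_on
          analytic_on_compose_gen[OF _ analytic_rGamma, unfolded o_def] analytic_intros) auto
  then show ?thesis
    by (simp add: Gamma_def)
qed

lemma expressions_meromorphic:
  assumes "f \<in> expressions"
  shows "f meromorphic_on UNIV"
  using assms
proof induction
  case (rational q p)
  then show ?case
    by (intro meromorphic_on_divide analytic_on_imp_meromorphic_on)
       (auto simp: analytic_on_open holomorphic_on_def field_differentiable_def intro: poly_DERIV)
next
  case (exponential \<alpha> \<beta>)
  show ?case by (intro analytic_on_imp_meromorphic_on analytic_intros)
next
  case (Gamma \<alpha> \<beta>)
  show ?case by (rule Gamma_linear_meromorphic)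
next
  case (factorial \<alpha> \<beta>)
  show ?case
    using Gamma_linear_meromorphic[of \<alpha> "\<beta> + 1"] by (simp add: factorial_fun_def add.assoc)
next
  case (binomial \<alpha> \<beta> \<gamma> \<delta>)
  have "(\<lambda>k. Gamma (\<alpha> * k + (\<beta> + 1)) / (Gamma (\<gamma> * k + (\<delta> + 1)) *
           Gamma ((\<alpha> - \<gamma>) * k + (\<beta> - \<delta> + 1)))) meromorphic_on UNIV"
    by (intro meromorphic_on_divide meromorphic_on_mult Gamma_linear_meromorphic)
  then show ?case
    by (simp add: binomial_fun_def factorial_fun_def algebra_simps)
next
  case (pochhammer \<alpha> \<beta> \<gamma> \<delta>)
  have "(\<lambda>k. Gamma ((\<alpha> + \<gamma>) * k + (\<beta> + \<delta>)) / Gamma (\<alpha> * k + \<beta>)) meromorphic_on UNIV"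
    by (intro meromorphic_on_divide Gamma_linear_meromorphic)
  then show ?case
    by (simp add: pochhammer_fun_def algebra_simps)
qed (intro meromorphic_intros; assumption)+

definition rational_function :: "(complex \<Rightarrow> complex) \<Rightarrow> bool" where
  "rational_function f \<longleftrightarrow> (\<exists>p q :: complex poly. q \<noteq> 0 \<and> (\<forall>\<^sub>\<approx>k. f k = poly p k / poly q k))"

definition hypergeometric_term :: "(complex \<Rightarrow> complex) \<Rightarrow> bool" where
  "hypergeometric_term t \<longleftrightarrow> admissible t \<and> rational_function (\<lambda>k. t k / t (k - 1))"

definition m_fold_hypergeometric_term :: "nat \<Rightarrow> (complex \<Rightarrow> complex) \<Rightarrow> bool" where
  "m_fold_hypergeometric_term m s \<longleftrightarrow>
     admissible s \<and> rational_function (\<lambda>k. s k / s (k - of_nat m))"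

end

theory Submission
  imports Defs
begin

text \<open>
  Scaling the variable by a nonzero constant preserves discrete exceptional sets, expressions and
  rational functions, so \<open>t\<^sub>k = s\<^sub>k\<^sub>m\<close> and \<open>s\<^sub>k = t\<^sub>k\<^sub>/\<^sub>m\<close> are mutually inverse correspondences
  between hypergeometric antidifferences of \<open>b\<close> and \<open>m\<close>-fold hypergeometric antidifferences of
  \<open>a\<close>.
\<close>

text \<open>A property holds outside a discrete closed set iff it holds on a punctured neighbourhood
  of every point, and multiplication by \<open>c\<close> carries small punctured neighbourhoods of
  \<open>z\<close> into those of \<open>c * z\<close>.\<close>

lemma eventually_cosparse_scale:
  fixes c :: "'a :: real_normed_field"
  assumes "\<forall>\<^sub>\<approx>k. P k" "c \<noteq> 0"
  shows "\<forall>\<^sub>\<approx>k. P (c * k)"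
proof -
  have "\<forall>\<^sub>F k in at z. P (c * k)" for z
  proof -
    \<comment> \<open>Besides continuity, the limit must avoid its own value: \<open>c * k\<close>
      differs from \<open>c * z\<close> for \<open>k\<close> different from \<open>z\<close> because
      \<open>c\<close> is nonzero.\<close>
    have "filterlim (\<lambda>k. c * k) (at (c * z)) (at z)"
      using assms(2)
      by (intro filterlim_atI tendsto_intros) (auto simp: eventually_at_filter)
    moreover have "\<forall>\<^sub>F k in at (c * z). P k"
      using assms(1) by (simp add: eventually_cosparse_open_eq)
    ultimately show ?thesis
      by (rule eventually_compose_filterlim[rotated])
  qed
  then show ?thesis
    by (simp add: eventually_cosparse_open_eq)
qed

text \<open>Every generator other than the rational ones takes arguments linear in \<open>k\<close>,
  so scaling only multiplies the slopes by \<open>c\<close>.\<close>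

lemma expressions_scale:
  assumes "f \<in> expressions" "c \<noteq> 0"
  shows "(\<lambda>k. f (c * k)) \<in> expressions"
  using assms(1)
proof induction
  case (rational q p)
  then show ?case
    \<comment> \<open>Composition with the nonconstant polynomial \<open>[:0, c:]\<close> realizes
      the scaling and keeps the denominator nonzero.\<close>
    using expressions.rational[of "pcompose q [:0, c:]" "pcompose p [:0, c:]"] assms(2)
    by (simp add: poly_pcompose pcompose_eq_0_iff mult.commute)
next
  case (exponential \<alpha> \<beta>)
  show ?case
    using expressions.exponential[of "\<alpha> * c" \<beta>] by (simp add: mult.assoc)
next
  case (Gamma \<alpha> \<beta>)
  show ?case
    using expressions.Gamma[of "\<alpha> * c" \<beta>] by (simp add: mult.assoc)
next
  case (factorial \<alpha> \<beta>)
  show ?case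
    using expressions.factorial[of "\<alpha> * c" \<beta>] by (simp add: mult.assoc)
next
  case (binomial \<alpha> \<beta> \<gamma> \<delta>)
  show ?case
    using expressions.binomial[of "\<alpha> * c" \<beta> "\<gamma> * c" \<delta>] by (simp add: mult.assoc)
next
  case (pochhammer \<alpha> \<beta> \<gamma> \<delta>)
  show ?case
    using expressions.pochhammer[of "\<alpha> * c" \<beta> "\<gamma> * c" \<delta>] by (simp add: mult.assoc)
qed (auto intro: expressions.intros)

lemma admissible_scale:
  assumes "admissible f" "c \<noteq> 0"
  shows "admissible (\<lambda>k. f (c * k))"
proof -
  have "(\<lambda>k. f (c * k)) \<in> expressions"
    using assms by (auto simp: admissible_def intro: expressions_scale)
  moreover have "\<not> (\<forall>\<^sub>\<approx>k. f (c * k) = 0)"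
    \<comment> \<open>If the scaled function vanished almost everywhere, scaling back by
      \<open>inverse c\<close> would make \<open>f\<close> itself vanish.\<close>
    using eventually_cosparse_scale[of "\<lambda>k. f (c * k) = 0" "inverse c"] assms
    by (auto simp: admissible_def mult.assoc[symmetric])
  ultimately show ?thesis
    by (simp add: admissible_def expressions_meromorphic)
qed

lemma rational_function_scale:
  assumes "rational_function f" "c \<noteq> 0"
  shows "rational_function (\<lambda>k. f (c * k))"
proof -
  obtain p q where pq: "q \<noteq> 0" "\<forall>\<^sub>\<approx>k. f k = poly p k / poly q k"
    using assms(1) by (auto simp: rational_function_def)
  have "\<forall>\<^sub>\<approx>k. f (c * k) = poly (pcompose p [:0, c:]) k / poly (pcompose q [:0, c:]) k"
    using eventually_cosparse_scale[OF pq(2) assms(2)]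
    by (simp add: poly_pcompose mult.commute)
  moreover have "pcompose q [:0, c:] \<noteq> 0"
    using pq(1) assms(2) by (simp add: pcompose_eq_0_iff)
  ultimately show ?thesis
    unfolding rational_function_def by blast
qed

text \<open>Since \<open>k / m - 1 = (k - m) / m\<close>, scaling by \<open>1 / m\<close> turns the
  unit shift in the quotient into a shift by \<open>m\<close>.\<close>

lemma m_fold_hypergeometric_term_scale:
  assumes "hypergeometric_term t" "m > 0"
  shows "m_fold_hypergeometric_term m (\<lambda>k. t (k / of_nat m))"
  using assms admissible_scale[of t "inverse (of_nat m)"]
    rational_function_scale[of "\<lambda>k. t k / t (k - 1)" "inverse (of_nat m)"]
  by (simp add: hypergeometric_term_def m_fold_hypergeometric_term_def field_simps)

lemma hypergeometric_term_scale:
  assumes "m_fold_hypergeometric_term m s" "m > 0"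
  shows "hypergeometric_term (\<lambda>k. s (k * of_nat m))"
  using assms admissible_scale[of s "of_nat m"]
    rational_function_scale[of "\<lambda>k. s k / s (k - of_nat m)" "of_nat m"]
  by (simp add: hypergeometric_term_def m_fold_hypergeometric_term_def algebra_simps)

theorem mainTheorem1:
  fixes m :: nat and a b :: "complex \<Rightarrow> complex"
  assumes "m > 0"
    and "admissible a"
    and "b = (\<lambda>k. a (k * of_nat m))"
  shows "(\<forall>t s. hypergeometric_term t \<and> (\<forall>\<^sub>\<approx>k. b k = t k - t (k - 1)) \<and>
             s = (\<lambda>k. t (k / of_nat m)) \<longrightarrow>
             (\<forall>\<^sub>\<approx>k. a k = s k - s (k - of_nat m)) \<and>
             rational_function (\<lambda>k. s k / s (k - of_nat m)) \<and>
             m_fold_hypergeometric_term m s) \<and>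
         ((\<nexists>t. hypergeometric_term t \<and> (\<forall>\<^sub>\<approx>k. b k = t k - t (k - 1))) \<longrightarrow>
          (\<nexists>s. m_fold_hypergeometric_term m s \<and> (\<forall>\<^sub>\<approx>k. a k = s k - s (k - of_nat m))))"
proof (intro conjI allI impI notI)
  fix t s
  assume "hypergeometric_term t \<and> (\<forall>\<^sub>\<approx>k. b k = t k - t (k - 1)) \<and>
    s = (\<lambda>k. t (k / of_nat m))"
  then have t: "hypergeometric_term t" "\<forall>\<^sub>\<approx>k. b k = t k - t (k - 1)"
    and s: "s = (\<lambda>k. t (k / of_nat m))"
    by auto
  show "\<forall>\<^sub>\<approx>k. a k = s k - s (k - of_nat m)"
    \<comment> \<open>At \<open>k / m\<close> the left side \<open>b\<close> becomes
      \<open>a k\<close>, as the factors \<open>m\<close> cancel.\<close>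
    using eventually_cosparse_scale[OF t(2), of "inverse (of_nat m)"] assms(1)
    by (simp add: assms(3) s field_simps)
  show m_fold: "m_fold_hypergeometric_term m s"
    unfolding s using t(1) assms(1) by (rule m_fold_hypergeometric_term_scale)
  then show "rational_function (\<lambda>k. s k / s (k - of_nat m))"
    by (simp add: m_fold_hypergeometric_term_def)
next
  assume no_t: "\<nexists>t. hypergeometric_term t \<and> (\<forall>\<^sub>\<approx>k. b k = t k - t (k - 1))"
  assume "\<exists>s. m_fold_hypergeometric_term m s \<and> (\<forall>\<^sub>\<approx>k. a k = s k - s (k - of_nat m))"
  then obtain s where s: "m_fold_hypergeometric_term m s"
    "\<forall>\<^sub>\<approx>k. a k = s k - s (k - of_nat m)"
    by blast
  \<comment> \<open>The forbidden antidifference of \<open>b\<close> is \<open>s\<close> evaluated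
    at \<open>k * m\<close>, because \<open>k * m - m = (k - 1) * m\<close>.\<close>
  have "\<forall>\<^sub>\<approx>k. b k = s (k * of_nat m) - s ((k - 1) * of_nat m)"
    using eventually_cosparse_scale[OF s(2), of "of_nat m"] assms(1)
    by (simp add: assms(3) algebra_simps)
  then show False
    using no_t hypergeometric_term_scale[OF s(1) assms(1)] by blast
qed

end
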